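(* Let $\alpha_1,\alpha_2$ be distinct null points and let $L\equiv\alpha_1\alpha_2$. Let $\alpha_3$ be a null point distinct from $\alpha_1$ and $\alpha_2$, let $M$ be a non-null line distinct from $\alpha_1\alpha_3$ and $\alpha_2\alpha_3$, and let $$a_1\equiv(\alpha_1\alpha_3)M,\qquad a_2\equiv(\alpha_2\alpha_3)M,$$ with $a_1$ and $a_2$ non-null. Then $q\equiv q(a_1,a_2)$ and $S\equiv S(L,M)$ are related by $$qS=1.$$ In particular $q$ is independent of $\alpha_3$.
   Context: Let $\mathbb F$ be a field of characteristic not two. A 3-proportion $x:y:z$ is a triple of elements of $\mathbb F$, not all zero, up to a common non-zero scalar. A point $a=[x:y:z]$ and a line $L=(l:m:n)$ are both 3-proportions. The point $[x:y:z]$ lies on the line $(l:m:n)$ when $lx+my-nz=0$. For distinct points $a,b$, the join $ab$ is the unique line through both; for distinct lines $L,M$, the meet $LM$ is the unique point lying on both. A point $[x:y:z]$ is null when $x^2+y^2-z^2=0$; a line $(l:m:n)$ is null when $l^2+m^2-n^2=0$. The join of two distinct null points is always a non-null line. The quadrance between non-null points $a_1=[x_1:y_1:z_1]$, $a_2=[x_2:y_2:z_2]$ is $$q(a_1,a_2)=1-\frac{(x_1x_2+y_1y_2-z_1z_2)^2}{(x_1^2+y_1^2-z_1^2)(x_2^2+y_2^2-z_2^2)}.$$ The spread between non-null lines $L_1=(l_1:m_1:n_1)$, $L_2=(l_2:m_2:n_2)$ is $$S(L_1,L_2)=1-\frac{(l_1l_2+m_1m_2-n_1n_2)^2}{(l_1^2+m_1^2-n_1^2)(l_2^2+m_2^2-n_2^2)}.$$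 Quadrances involving null points and spreads involving null lines are undefined. *)

theory Defs
  imports Main
begin

definition prop_rel :: "'a::field \<times> 'a \<times> 'a \<Rightarrow> 'a \<times> 'a \<times> 'a \<Rightarrow> bool"
  where "prop_rel = (\<lambda>(x, y, z) (x', y', z').
    (x, y, z) \<noteq> (0, 0, 0) \<and> (\<exists>c. c \<noteq> 0 \<and> x' = c * x \<and> y' = c * y \<and> z' = c * z))"

lemma prop_rel_part_equivp: "part_equivp prop_rel"
proof (rule part_equivpI)
  show "\<exists>u. prop_rel u (u :: 'a \<times> 'a \<times> 'a)"
    by (rule exI[of _ "(1, 0, 0)"]) (auto simp: prop_rel_def intro!: exI[of _ 1])
  show "symp (prop_rel :: 'a \<times> 'a \<times> 'a \<Rightarrow> _)"
  proof (rule sympI, clarify)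
    fix x y z x' y' z' :: 'a
    assume "prop_rel (x, y, z) (x', y', z')"
    then obtain c where c: "c \<noteq> 0" "x' = c * x" "y' = c * y" "z' = c * z" "(x, y, z) \<noteq> (0, 0, 0)"
      by (auto simp: prop_rel_def)
    then show "prop_rel (x', y', z') (x, y, z)"
      unfolding prop_rel_def by (auto intro!: exI[of _ "inverse c"])
  qed
  show "transp (prop_rel :: 'a \<times> 'a \<times> 'a \<Rightarrow> _)"
  proof (rule transpI, clarify)
    fix x y z x' y' z' x'' y'' z'' :: 'a
    assume "prop_rel (x, y, z) (x', y', z')" "prop_rel (x', y', z') (x'', y'', z'')"
    then obtain c d where "c \<noteq> 0" "x' = c * x" "y' = c * y" "z' = c * z" "(x, y, z) \<noteq> (0, 0, 0)"
      "d \<noteq> 0" "x'' = d * x'" "y'' = d * y'" "z'' = d * z'"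
      by (auto simp: prop_rel_def)
    then show "prop_rel (x, y, z) (x'', y'', z'')"
      unfolding prop_rel_def by (auto intro!: exI[of _ "d * c"])
  qed
qed

quotient_type (overloaded) 'a proportion = "'a::field \<times> 'a \<times> 'a" / partial: prop_rel
  by (rule prop_rel_part_equivp)

type_synonym 'a point = "'a proportion"
type_synonym 'a line = "'a proportion"

lift_definition lies_on :: "'a::field point \<Rightarrow> 'a line \<Rightarrow> bool"
  is "\<lambda>(x, y, z) (l, m, n). l * x + m * y - n * z = 0"
proof (clarsimp simp: prop_rel_def simp del: right_minus_eq)
  fix x y z l m n c d :: 'a
  assume "c \<noteq> 0" "d \<noteq> 0"
  moreover have "d * l * (c * x) + d * m * (c * y) - d * n * (c * z) = (c * d) * (l * x + m * y - n * z)"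
    by (simp add: algebra_simps)
  ultimately show "(l * x + m * y - n * z = 0) =
      (d * l * (c * x) + d * m * (c * y) - d * n * (c * z) = 0)"
    by simp
qed

definition join :: "'a::field point \<Rightarrow> 'a point \<Rightarrow> 'a line"
  where "join a b = (THE L. lies_on a L \<and> lies_on b L)"

definition meet :: "'a::field line \<Rightarrow> 'a line \<Rightarrow> 'a point"
  where "meet L M = (THE a. lies_on a L \<and> lies_on a M)"

lift_definition null_point :: "'a::field point \<Rightarrow> bool"
  is "\<lambda>(x, y, z). x\<^sup>2 + y\<^sup>2 - z\<^sup>2 = 0"
proof (clarsimp simp: prop_rel_def simp del: right_minus_eq)
  fix x y z c :: 'a
  assume "c \<noteq> 0"
  moreover have "(c * x)\<^sup>2 + (c * y)\<^sup>2 - (c * z)\<^sup>2 = c\<^sup>2 * (x\<^sup>2 + y\<^sup>2 - z\<^sup>2)"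
    by (simp add: algebra_simps power2_eq_square)
  ultimately show "(x\<^sup>2 + y\<^sup>2 - z\<^sup>2 = 0) = ((c * x)\<^sup>2 + (c * y)\<^sup>2 - (c * z)\<^sup>2 = 0)"
    by simp
qed

lift_definition null_line :: "'a::field line \<Rightarrow> bool"
  is "\<lambda>(l, m, n). l\<^sup>2 + m\<^sup>2 - n\<^sup>2 = 0"
  using null_point.rsp unfolding rel_fun_def by blast

text \<open>
  Division by zero makes \<open>quadrance\<close> and \<open>spread\<close> total: both take the meaningless value 1
  when an argument is null.
\<close>

lift_definition quadrance :: "'a::field point \<Rightarrow> 'a point \<Rightarrow> 'a"
  is "\<lambda>(x1, y1, z1) (x2, y2, z2).
    1 - (x1 * x2 + y1 * y2 - z1 * z2)\<^sup>2 /
      ((x1\<^sup>2 + y1\<^sup>2 - z1\<^sup>2) * (x2\<^sup>2 + y2\<^sup>2 - z2\<^sup>2))"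
proof (clarsimp simp: prop_rel_def simp del: right_minus_eq)
  fix x1 y1 z1 x2 y2 z2 c d :: 'a
  assume cd: "c \<noteq> 0" "d \<noteq> 0"
  have num: "(c * x1 * (d * x2) + c * y1 * (d * y2) - c * z1 * (d * z2))\<^sup>2 =
      (c * d)\<^sup>2 * (x1 * x2 + y1 * y2 - z1 * z2)\<^sup>2"
    by (simp add: algebra_simps flip: power_mult_distrib)
  have den: "((c * x1)\<^sup>2 + (c * y1)\<^sup>2 - (c * z1)\<^sup>2) * ((d * x2)\<^sup>2 + (d * y2)\<^sup>2 - (d * z2)\<^sup>2) =
      (c * d)\<^sup>2 * ((x1\<^sup>2 + y1\<^sup>2 - z1\<^sup>2) * (x2\<^sup>2 + y2\<^sup>2 - z2\<^sup>2))"
    by (simp add: algebra_simps power2_eq_square)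
  show "(x1 * x2 + y1 * y2 - z1 * z2)\<^sup>2 / ((x1\<^sup>2 + y1\<^sup>2 - z1\<^sup>2) * (x2\<^sup>2 + y2\<^sup>2 - z2\<^sup>2)) =
      (c * x1 * (d * x2) + c * y1 * (d * y2) - c * z1 * (d * z2))\<^sup>2 /
      (((c * x1)\<^sup>2 + (c * y1)\<^sup>2 - (c * z1)\<^sup>2) * ((d * x2)\<^sup>2 + (d * y2)\<^sup>2 - (d * z2)\<^sup>2))"
    unfolding num den using cd by simp
qed

lift_definition spread :: "'a::field line \<Rightarrow> 'a line \<Rightarrow> 'a"
  is "\<lambda>(l1, m1, n1) (l2, m2, n2).
    1 - (l1 * l2 + m1 * m2 - n1 * n2)\<^sup>2 /
      ((l1\<^sup>2 + m1\<^sup>2 - n1\<^sup>2) * (l2\<^sup>2 + m2\<^sup>2 - n2\<^sup>2))"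
  using quadrance.rsp unfolding rel_fun_def by blast

lemma cross_parallel:
  fixes x1 :: "'a::field"
  assumes nz: "(x1, y1, z1) \<noteq> (0, 0, 0)" "(x2, y2, z2) \<noteq> (0, 0, 0)"
    and cross: "y1 * z2 = z1 * y2" "z1 * x2 = x1 * z2" "x1 * y2 = y1 * x2"
  shows "prop_rel (x1, y1, z1) (x2, y2, z2)"
proof -
  consider "x1 \<noteq> 0" | "y1 \<noteq> 0" | "z1 \<noteq> 0" using nz by auto
  then have "\<exists>c. x2 = c * x1 \<and> y2 = c * y1 \<and> z2 = c * z1"
  proof cases
    case 1
    then show ?thesis using cross by (intro exI[of _ "x2 / x1"]) (simp add: field_simps)
  next
    case 2
    then show ?thesis using cross by (intro exI[of _ "y2 / y1"]) (simp add: field_simps)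
  next
    case 3
    then show ?thesis using cross by (intro exI[of _ "z2 / z1"]) (simp add: field_simps)
  qed
  then show ?thesis using nz by (auto simp: prop_rel_def)
qed

lemma lies_on_commute: "lies_on a L \<longleftrightarrow> lies_on L a"
  by transfer (auto simp: mult.commute)

lemma join_exists:
  fixes a b :: "'a::field point"
  assumes "a \<noteq> b"
  shows "\<exists>L. lies_on a L \<and> lies_on b L"
  using assms
proof transfer
  fix a b :: "'a \<times> 'a \<times> 'a"
  assume ab: "prop_rel a a" "prop_rel b b" "\<not> prop_rel a b"
  obtain x1 y1 z1 where a: "a = (x1, y1, z1)" by (cases a)
  obtain x2 y2 z2 where b: "b = (x2, y2, z2)" by (cases b)
  have nz: "(x1, y1, z1) \<noteq> (0, 0, 0)" "(x2, y2, z2) \<noteq> (0, 0, 0)"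
    using ab by (auto simp: a b prop_rel_def)
  let ?L = "(y1 * z2 - z1 * y2, z1 * x2 - x1 * z2, y1 * x2 - x1 * y2)"
  have "?L \<noteq> (0, 0, 0)"
    using cross_parallel[OF nz] ab(3) by (auto simp: a b)
  then have L: "prop_rel ?L ?L"
    by (simp add: prop_rel_def) (rule exI[of _ 1], simp)
  show "\<exists>L\<in>Collect (\<lambda>x. prop_rel x x).
          (case a of (x, y, z) \<Rightarrow> \<lambda>(l, m, n). l * x + m * y - n * z = 0) L \<and>
          (case b of (x, y, z) \<Rightarrow> \<lambda>(l, m, n). l * x + m * y - n * z = 0) L"
    by (rule bexI[of _ ?L]) (use L in \<open>simp_all add: a b algebra_simps\<close>)
qed

lemma join_unique:
  fixes a b :: "'a::field point"
  assumes "a \<noteq> b" "lies_on a L" "lies_on b L" "lies_on a L'" "lies_on b L'"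
  shows "L = L'"
  using assms
proof (transfer, clarsimp)
  fix x1 y1 z1 x2 y2 z2 l m n l' m' n' :: 'a
  assume *: "prop_rel (x1, y1, z1) (x1, y1, z1)" "prop_rel (x2, y2, z2) (x2, y2, z2)"
    "\<not> prop_rel (x1, y1, z1) (x2, y2, z2)"
    "prop_rel (l, m, n) (l, m, n)" "prop_rel (l', m', n') (l', m', n')"
  assume eqs: "l * x1 + m * y1 = n * z1" "l * x2 + m * y2 = n * z2"
    "l' * x1 + m' * y1 = n' * z1" "l' * x2 + m' * y2 = n' * z2"
  have nz: "(x1, y1, z1) \<noteq> (0, 0, 0)" "(x2, y2, z2) \<noteq> (0, 0, 0)"
      "(l, m, n) \<noteq> (0, 0, 0)" "(l', m', n') \<noteq> (0, 0, 0)"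
    using * by (auto simp: prop_rel_def)
  let ?a = "(m * n' - n * m', n * l' - l * n', m * l' - l * m')"
  have "?a = (0, 0, 0)"
  proof (rule ccontr)
    assume "?a \<noteq> (0, 0, 0)"
    have "prop_rel ?a (x, y, z)"
      if "(x, y, z) \<noteq> (0, 0, 0)" "l * x + m * y = n * z" "l' * x + m' * y = n' * z" for x y z
    proof (rule cross_parallel[OF \<open>?a \<noteq> (0, 0, 0)\<close> that(1)])
      show "(n * l' - l * n') * z = (m * l' - l * m') * y"
        "(m * l' - l * m') * x = (m * n' - n * m') * z"
        "(m * n' - n * m') * y = (n * l' - l * n') * x"
        using that(2,3) by algebra+
    qed
    then have "prop_rel ?a (x1, y1, z1)" "prop_rel ?a (x2, y2, z2)"
      using nz eqs by blast+
    then have "prop_rel (x1, y1, z1) (x2, y2, z2)"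
      using prop_rel_part_equivp by (meson part_equivp_symp part_equivp_transp)
    with *(3) show False by contradiction
  qed
  then show "prop_rel (l, m, n) (l', m', n')"
    using cross_parallel[OF nz(3,4)] by simp
qed

lemma join_ex1: "a \<noteq> b \<Longrightarrow> \<exists>!L. lies_on a L \<and> lies_on b L"
  using join_exists join_unique by blast

lemma meet_ex1: "L \<noteq> M \<Longrightarrow> \<exists>!a. lies_on a L \<and> lies_on a M"
  using join_ex1[of L M] by (simp add: lies_on_commute)

lemma lies_on_join: "a \<noteq> b \<Longrightarrow> lies_on a (join a b) \<and> lies_on b (join a b)"
  unfolding join_def by (rule theI', rule join_ex1)

text \<open>
  The join of two distinct null points is non-null, so its spread with a non-null line is
  meaningful.
\<close>

lemma join_not_null:
  assumes "null_point a" "null_point b" "a \<noteq> b"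
  shows "\<not> null_line (join a b)"
proof
  assume "null_line (join a b)"
  moreover have "null_point c \<longleftrightarrow> lies_on c c" "null_line c \<longleftrightarrow> lies_on c c" for c :: "'a proportion"
    by (transfer; auto simp: power2_eq_square)+
  ultimately have "lies_on (join a b) (join a b)" "lies_on a a" "lies_on b b"
    using assms by auto
  then have "join a b = a" "join a b = b"
    using lies_on_join[OF assms(3)] join_unique lies_on_commute by metis+
  with assms(3) show False by simp
qed

end

theory Submission
  imports Defs
begin

text \<open>
  Incidence, nullity, quadrance and spread all come from the bilinear form
  \<open>\<langle>u, v\<rangle> = u\<^sub>1v\<^sub>1 + u\<^sub>2v\<^sub>2 - u\<^sub>3v\<^sub>3\<close>. Let the null points be represented by
  \<open>A\<^sub>1, A\<^sub>2, A\<^sub>3\<close> and \<open>M\<close> by \<open>m\<close>, and put \<open>p\<^sub>i = \<langle>A\<^sub>i, m\<rangle>\<close>, \<open>g\<^sub>i\<^sub>j = \<langle>A\<^sub>i, A\<^sub>j\<rangle>\<close>.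
  Then \<open>a\<^sub>1 = p\<^sub>3A\<^sub>1 - p\<^sub>1A\<^sub>3\<close> and \<open>a\<^sub>2 = p\<^sub>3A\<^sub>2 - p\<^sub>2A\<^sub>3\<close>, so that
  \<open>q = 1 - (p\<^sub>3g\<^sub>1\<^sub>2 - p\<^sub>2g\<^sub>1\<^sub>3 - p\<^sub>1g\<^sub>2\<^sub>3)\<^sup>2 / (4p\<^sub>1p\<^sub>2g\<^sub>1\<^sub>3g\<^sub>2\<^sub>3)\<close>, while
  \<open>S = 2p\<^sub>1p\<^sub>2 / (g\<^sub>1\<^sub>2\<langle>m, m\<rangle>)\<close>. The vanishing of the Gram determinant of the four vectors
  \<open>A\<^sub>1, A\<^sub>2, A\<^sub>3, m\<close> in a three-dimensional space is exactly \<open>qS = 1\<close>.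
\<close>

section \<open>Identities for the form on triples\<close>

fun form :: "'a::field \<times> 'a \<times> 'a \<Rightarrow> 'a \<times> 'a \<times> 'a \<Rightarrow> 'a"
  where "form (x1, y1, z1) (x2, y2, z2) = x1 * x2 + y1 * y2 - z1 * z2"

fun lcomb :: "'a::field \<Rightarrow> 'a \<times> 'a \<times> 'a \<Rightarrow> 'a \<Rightarrow> 'a \<times> 'a \<times> 'a \<Rightarrow> 'a \<times> 'a \<times> 'a"
  where "lcomb a (x1, y1, z1) b (x2, y2, z2) = (a * x1 + b * x2, a * y1 + b * y2, a * z1 + b * z2)"

text \<open>The third coordinate has the sign opposite to the usual one because \<open>form\<close> has signature \<open>(2, 1)\<close>.\<close>

fun cross :: "'a::field \<times> 'a \<times> 'a \<Rightarrow> 'a \<times> 'a \<times> 'a \<Rightarrow> 'a \<times> 'a \<times> 'a"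
  where "cross (x1, y1, z1) (x2, y2, z2) =
    (y1 * z2 - z1 * y2, z1 * x2 - x1 * z2, y1 * x2 - x1 * y2)"

lemma form_commute: "form u v = form v u"
  by (cases u; cases v) (simp add: mult.commute)

lemma form_lcomb_left: "form (lcomb a u b v) w = a * form u w + b * form v w"
  by (cases u; cases v; cases w) (simp add: algebra_simps)

lemma form_lcomb_right: "form w (lcomb a u b v) = a * form w u + b * form w v"
  by (cases u; cases v; cases w) (simp add: algebra_simps)

lemma form_cross_self: "form u (cross u v) = 0" "form v (cross u v) = 0"
  by (cases u; cases v; simp add: algebra_simps)+

text \<open>Lagrange's identity with the sign reversed, because \<open>form\<close> has determinant
  -1.\<close>

lemma form_cross_cross:
  "form (cross u v) (cross w t) = form u t * form v w - form u w * form v t" for u :: "'a::field \<times> 'a \<times> 'a"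
  by (cases u; cases v; cases w; cases t) (simp add: algebra_simps)

text \<open>Cramer's rule with the determinant left multiplied out, so linear dependence of
  \<open>u\<close>, \<open>v\<close>, \<open>w\<close> is allowed. The term \<open>0 m\<close> is a
  filler that lets \<open>lcomb\<close> express a scalar multiple.\<close>

lemma cramer:
  fixes u :: "'a::field \<times> 'a \<times> 'a"
  shows "lcomb (form u (cross v w)) m 0 m =
    lcomb 1 (lcomb (form u m) (cross v w) (form v m) (cross w u)) (form w m) (cross u v)"
  by (cases u; cases v; cases w; cases m) (simp add: algebra_simps)

text \<open>\<open>form u (cross v w)\<close> is the determinant of the three triples. Its square is
  minus their Gram determinant, again because \<open>form\<close> has determinant -1.\<close>

lemma det_squared:
  fixes u :: "'a::field \<times> 'a \<times> 'a"
  shows "(form u (cross v w))\<^sup>2 =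
    form u u * (form v w)\<^sup>2 + form v v * (form u w)\<^sup>2 + form w w * (form u v)\<^sup>2
      - form u u * form v v * form w w - 2 * form u v * form u w * form v w"
  by (cases u; cases v; cases w) (simp add: algebra_simps power2_eq_square)

lemma gram_null:
  fixes u :: "'a::field \<times> 'a \<times> 'a"
  assumes "form u u = 0" "form v v = 0" "form w w = 0"
  shows "4 * form u m * form v m * form u w * form v w
      - (form w m * form u v - form v m * form u w - form u m * form v w)\<^sup>2
    = 2 * form u v * form u w * form v w * form m m"
proof -
  \<comment> \<open>Evaluating the form on \<open>?D\<close> times \<open>m\<close>, once directly
    and once through \<open>cramer\<close>, gives the vanishing of the four-vector Gram
    determinant.\<close>
  let ?D = "form u (cross v w)"
  have "?D\<^sup>2 * form m m = form (lcomb ?D m 0 m) (lcomb ?D m 0 m)"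
    by (simp add: form_lcomb_left form_lcomb_right power2_eq_square)
  also have "\<dots> = (form u m * form v w)\<^sup>2 + (form v m * form u w)\<^sup>2 + (form w m * form u v)\<^sup>2
      - 2 * form u m * form v m * form u w * form v w
      - 2 * form u m * form w m * form u v * form v w
      - 2 * form v m * form w m * form u v * form u w"
    unfolding cramer form_lcomb_left form_lcomb_right form_cross_cross
    using assms
    by (simp add: form_commute[of w u] form_commute[of w v] form_commute[of v u]
        algebra_simps power2_eq_square)
  finally have "?D\<^sup>2 * form m m = \<dots>" .
  moreover have "?D\<^sup>2 = - (2 * form u v * form u w * form v w)"
    using assms by (simp add: det_squared)
  ultimately show ?thesis
    by (simp add: algebra_simps power2_eq_square)
qed

section \<open>Passing from proportions to representative triples\<close>

lemma proportion_cases: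
  obtains u where "prop_rel u u" "a = abs_proportion u"
  by (metis Quotient_proportion Quotient_abs_rep Quotient_rep_reflp)

lemma prop_rel_refl_iff: "prop_rel u u \<longleftrightarrow> u \<noteq> (0, 0, 0)"
  by (cases u) (auto simp: prop_rel_def intro: exI[of _ 1])

context
  fixes u v :: "'a::field \<times> 'a \<times> 'a"
  assumes uv: "prop_rel u u" "prop_rel v v"
begin

lemma lies_on_abs: "lies_on (abs_proportion u) (abs_proportion v) \<longleftrightarrow> form u v = 0"
  using uv by (cases u; cases v) (simp add: lies_on.abs_eq mult.commute)

lemma quadrance_abs:
  "quadrance (abs_proportion u) (abs_proportion v) = 1 - (form u v)\<^sup>2 / (form u u * form v v)"
  using uv by (cases u; cases v) (simp add: quadrance.abs_eq power2_eq_square)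

lemma spread_abs:
  "spread (abs_proportion u) (abs_proportion v) = 1 - (form u v)\<^sup>2 / (form u u * form v v)"
  using uv by (cases u; cases v) (simp add: spread.abs_eq power2_eq_square)

end

text \<open>Points and lines share one type, so the same triple is a point and its polar line; null
  means self-polar.\<close>

lemma null_point_iff_lies_on: "null_point a \<longleftrightarrow> lies_on a a"
  by transfer (auto simp: power2_eq_square)

lemma null_line_iff_lies_on: "null_line a \<longleftrightarrow> lies_on a a"
  by transfer (auto simp: power2_eq_square)

text \<open>If \<open>a\<close> lay on \<open>b\<close>, the polar lines of \<open>a\<close> and
  \<open>b\<close> would both pass through both points, hence coincide.\<close>

lemma null_points_not_orthogonal:
  assumes "null_point a" "null_point b" "a \<noteq> b"
  shows "\<not> lies_on a b"
  using assms join_unique[of a b a b] lies_on_commute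
  by (auto simp: null_point_iff_lies_on)

section \<open>Joins and meets in coordinates\<close>

lemma join_eqI: "\<lbrakk>a \<noteq> b; lies_on a L; lies_on b L\<rbrakk> \<Longrightarrow> join a b = L"
  using join_unique lies_on_join by blast

lemma meet_eqI: "\<lbrakk>L \<noteq> M; lies_on a L; lies_on a M\<rbrakk> \<Longrightarrow> meet L M = a"
  unfolding meet_def by (rule the1_equality[OF meet_ex1]) auto

lemma join_abs:
  assumes "prop_rel u u" "prop_rel v v" "form u v \<noteq> 0" "form u u = 0" "form v v = 0"
  shows "prop_rel (cross u v) (cross u v)"
    and "join (abs_proportion u) (abs_proportion v) = abs_proportion (cross u v)"
proof -
  \<comment> \<open>For isotropic \<open>u\<close> and \<open>v\<close> this value is the square of
    \<open>form u v\<close>.\<close>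
  have "form (cross u v) (cross u v) \<noteq> 0"
    using assms by (simp add: form_cross_cross form_commute[of v u])
  then show c: "prop_rel (cross u v) (cross u v)"
    by (auto simp: prop_rel_refl_iff)
  have "abs_proportion u \<noteq> abs_proportion v"
    using assms by (metis lies_on_abs)
  then show "join (abs_proportion u) (abs_proportion v) = abs_proportion (cross u v)"
    by (rule join_eqI) (simp_all add: lies_on_abs assms c form_cross_self)
qed

lemma meet_join_abs:
  assumes "prop_rel u u" "prop_rel v v" "prop_rel m m"
    and "form u v \<noteq> 0" "form u u = 0" "form v v = 0"
    and "abs_proportion m \<noteq> join (abs_proportion u) (abs_proportion v)"
  defines "a \<equiv> lcomb (form v m) u (- form u m) v"
  shows "prop_rel a a"
    and "meet (join (abs_proportion u) (abs_proportion v)) (abs_proportion m) = abs_proportion a"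
proof -
  have ne: "abs_proportion u \<noteq> abs_proportion v"
    using assms by (metis lies_on_abs)
  have "form u m \<noteq> 0 \<or> form v m \<noteq> 0"
    using assms join_eqI[OF ne, of "abs_proportion m"] by (auto simp: lies_on_abs)
  \<comment> \<open>Pairing with \<open>u\<close> and \<open>v\<close> recovers the coefficients of
    \<open>a\<close> up to the factor \<open>form u v\<close>, so \<open>a\<close> is not the zero
    triple.\<close>
  moreover have "form u a = - form u m * form u v" "form v a = form v m * form u v"
    by (simp_all add: a_def form_lcomb_right form_commute[of v u] assms)
  ultimately have "form u a \<noteq> 0 \<or> form v a \<noteq> 0"
    using assms(4) by auto
  then show a: "prop_rel a a"
    by (cases u; cases v) (auto simp: prop_rel_refl_iff)
  have "form a (cross u v) = 0" "form a m = 0"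
    by (simp_all add: a_def form_lcomb_left form_cross_self)
  then show "meet (join (abs_proportion u) (abs_proportion v)) (abs_proportion m) = abs_proportion a"
    using assms(1-7) a join_abs[OF assms(1,2,4-6)] by (intro meet_eqI) (auto simp: lies_on_abs)
qed

section \<open>Spread and quadrance as values of the form\<close>

lemma spread_join_null:
  assumes "prop_rel u u" "prop_rel v v" "prop_rel m m"
    and "form u v \<noteq> 0" "form u u = 0" "form v v = 0" "form m m \<noteq> 0"
  shows "spread (join (abs_proportion u) (abs_proportion v)) (abs_proportion m) =
    2 * form u m * form v m / (form u v * form m m)"
proof -
  \<comment> \<open>The numerator of the spread is the squared determinant of \<open>m\<close>,
    \<open>u\<close>, \<open>v\<close>.\<close>
  have "(form (cross u v) m)\<^sup>2 = form m m * (form u v)\<^sup>2 - 2 * form u m * form v m * form u v"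
    using assms det_squared[of m u v]
    by (simp add: form_commute[of m u] form_commute[of m v] form_commute[of m "cross u v"]
        algebra_simps)
  moreover have "form (cross u v) (cross u v) = (form u v)\<^sup>2"
    using assms by (simp add: form_cross_cross form_commute[of v u] power2_eq_square)
  ultimately have "spread (join (abs_proportion u) (abs_proportion v)) (abs_proportion m) =
      1 - (form m m * (form u v)\<^sup>2 - 2 * form u m * form v m * form u v) /
        ((form u v)\<^sup>2 * form m m)"
    using assms join_abs[of u v] by (simp add: spread_abs)
  then show ?thesis
    using assms by (simp add: field_simps power2_eq_square)
qed

lemma quadrance_mult_spread:
  fixes \<alpha>1 \<alpha>2 \<alpha>3 :: "'a::field point"
  assumes null: "null_point \<alpha>1" "null_point \<alpha>2" "null_point \<alpha>3"
    and ne: "\<alpha>1 \<noteq> \<alpha>2" "\<alpha>3 \<noteq> \<alpha>1" "\<alpha>3 \<noteq> \<alpha>2"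
    and M: "\<not> null_line M" "M \<noteq> join \<alpha>1 \<alpha>3" "M \<noteq> join \<alpha>2 \<alpha>3"
    and nn: "\<not> null_point (meet (join \<alpha>1 \<alpha>3) M)" "\<not> null_point (meet (join \<alpha>2 \<alpha>3) M)"
  shows "quadrance (meet (join \<alpha>1 \<alpha>3) M) (meet (join \<alpha>2 \<alpha>3) M) * spread (join \<alpha>1 \<alpha>2) M = 1"
proof -
  obtain u where u: "prop_rel u u" "\<alpha>1 = abs_proportion u" by (rule proportion_cases)
  obtain v where v: "prop_rel v v" "\<alpha>2 = abs_proportion v" by (rule proportion_cases)
  obtain w where w: "prop_rel w w" "\<alpha>3 = abs_proportion w" by (rule proportion_cases)
  obtain m where m: "prop_rel m m" "M = abs_proportion m" by (rule proportion_cases)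
  have iso: "form u u = 0" "form v v = 0" "form w w = 0"
    using null u v w by (simp_all add: null_point_iff_lies_on lies_on_abs)
  have g: "form u v \<noteq> 0" "form u w \<noteq> 0" "form v w \<noteq> 0"
    using null_points_not_orthogonal null ne u v w by (metis lies_on_abs)+
  have mm: "form m m \<noteq> 0"
    using M m by (simp add: null_line_iff_lies_on lies_on_abs)
  define a where "a = lcomb (form w m) u (- form u m) w"
  define b where "b = lcomb (form w m) v (- form v m) w"
  have a: "prop_rel a a" "meet (join \<alpha>1 \<alpha>3) M = abs_proportion a"
    using meet_join_abs[of u w m] u w m g iso M by (simp_all add: a_def)
  have b: "prop_rel b b" "meet (join \<alpha>2 \<alpha>3) M = abs_proportion b"
    using meet_join_abs[of v w m] v w m g iso M by (simp_all add: b_def)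
  have aa: "form a a = - 2 * form u m * form w m * form u w"
    by (simp add: a_def form_lcomb_left form_lcomb_right iso form_commute[of w u])
  have bb: "form b b = - 2 * form v m * form w m * form v w"
    by (simp add: b_def form_lcomb_left form_lcomb_right iso form_commute[of w v])
  have ab: "form a b = form w m *
      (form w m * form u v - form v m * form u w - form u m * form v w)"
    by (simp add: a_def b_def form_lcomb_left form_lcomb_right iso form_commute[of w v]
        algebra_simps)
  \<comment> \<open>Each of \<open>aa\<close> and \<open>bb\<close> is a product, so non-nullity
    makes all its factors non-zero, 2 included.\<close>
  have "form a a \<noteq> 0" "form b b \<noteq> 0"
    using nn a b by (simp_all add: null_point_iff_lies_on lies_on_abs)
  then have p: "form u m \<noteq> 0" "form v m \<noteq> 0" "form w m \<noteq> 0" "(2::'a) \<noteq> 0"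
    by (auto simp: aa bb)
  let ?e = "form w m * form u v - form v m * form u w - form u m * form v w"
  let ?d = "4 * form u m * form v m * form u w * form v w"
  have "(2::'a) * 2 \<noteq> 0" using p(4) by (simp only: mult_eq_0_iff) simp
  then have d: "?d \<noteq> 0" using p g by simp
  \<comment> \<open>The factor \<open>form w m\<close> enters \<open>ab\<close> once and each of
    \<open>aa\<close> and \<open>bb\<close> once, so its square cancels.\<close>
  have "(form a b)\<^sup>2 / (form a a * form b b) = ((form w m)\<^sup>2 * ?e\<^sup>2) / ((form w m)\<^sup>2 * ?d)"
    by (simp add: ab aa bb power_mult_distrib power2_eq_square algebra_simps)
  also have "\<dots> = ?e\<^sup>2 / ?d"
    using p by simp
  finally have "quadrance (abs_proportion a) (abs_proportion b) = (?d - ?e\<^sup>2) / ?d"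
    using d by (simp add: quadrance_abs a b diff_divide_distrib)
  also have "\<dots> = 2 * form u v * form u w * form v w * form m m / ?d"
    by (simp only: gram_null[OF iso])
  finally have q: "quadrance (abs_proportion a) (abs_proportion b) =
      2 * form u v * form u w * form v w * form m m / ?d" .
  have s: "spread (join \<alpha>1 \<alpha>2) M = 2 * form u m * form v m / (form u v * form m m)"
    using spread_join_null[of u v m] u v m g iso mm by simp
  show ?thesis
    unfolding a b q s using d p g mm by (simp add: field_simps)
qed

theorem theorem90:
  fixes \<alpha>1 \<alpha>2 \<alpha>3 :: "'a::field point" and L M :: "'a line" and a1 a2 :: "'a point"
  assumes "CHAR('a) \<noteq> 2"
    and "null_point \<alpha>1" "null_point \<alpha>2" "\<alpha>1 \<noteq> \<alpha>2"
    and "L = join \<alpha>1 \<alpha>2"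
    and "null_point \<alpha>3" "\<alpha>3 \<noteq> \<alpha>1" "\<alpha>3 \<noteq> \<alpha>2"
    and "\<not> null_line M" "M \<noteq> join \<alpha>1 \<alpha>3" "M \<noteq> join \<alpha>2 \<alpha>3"
    and "a1 = meet (join \<alpha>1 \<alpha>3) M" "a2 = meet (join \<alpha>2 \<alpha>3) M"
    and "\<not> null_point a1" "\<not> null_point a2"
  shows "quadrance a1 a2 * spread L M = 1 \<and>
    (\<forall>\<beta>3 b1 b2. null_point \<beta>3 \<and> \<beta>3 \<noteq> \<alpha>1 \<and> \<beta>3 \<noteq> \<alpha>2 \<and>
      M \<noteq> join \<alpha>1 \<beta>3 \<and> M \<noteq> join \<alpha>2 \<beta>3 \<and>
      b1 = meet (join \<alpha>1 \<beta>3) M \<and> b2 = meet (join \<alpha>2 \<beta>3) M \<and>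
      \<not> null_point b1 \<and> \<not> null_point b2 \<longrightarrow> quadrance b1 b2 = quadrance a1 a2)"
proof (intro conjI allI impI)
  show qS: "quadrance a1 a2 * spread L M = 1"
    using quadrance_mult_spread[of \<alpha>1 \<alpha>2 \<alpha>3 M] assms by simp
  fix \<beta>3 b1 b2
  assume "null_point \<beta>3 \<and> \<beta>3 \<noteq> \<alpha>1 \<and> \<beta>3 \<noteq> \<alpha>2 \<and>
      M \<noteq> join \<alpha>1 \<beta>3 \<and> M \<noteq> join \<alpha>2 \<beta>3 \<and>
      b1 = meet (join \<alpha>1 \<beta>3) M \<and> b2 = meet (join \<alpha>2 \<beta>3) M \<and>
      \<not> null_point b1 \<and> \<not> null_point b2"
  then have "quadrance b1 b2 * spread L M = 1"
    using quadrance_mult_spread[of \<alpha>1 \<alpha>2 \<beta>3 M] assms by auto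
  \<comment> \<open>The spread does not involve the third null point, and it is non-zero because its
    product with a quadrance is 1; hence it cancels.\<close>
  with qS have "quadrance b1 b2 * spread L M = quadrance a1 a2 * spread L M" "spread L M \<noteq> 0"
    by auto
  then show "quadrance b1 b2 = quadrance a1 a2"
    by simp
qed

end
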